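(* Let $f\colon A\to B$ be a differential homomorphism of Keigher differential rings, and let $\mathfrak p$ be a prime differential ideal of $A$. Then the following assertions hold: (1) if $(f^* )^{-1}(\mathfrak p)\neq\varnothing$, then $(f^*_\Delta)^{-1}(\mathfrak p)\neq\varnothing$; (2) if $f^*\colon \operatorname{Spec}B\to\operatorname{Spec}A$ is surjective, then so is $f^*_\Delta\colon \operatorname{Spec}^\Delta B\to\operatorname{Spec}^\Delta A$; (3) if $f$ has the going-up property, then $f$ has the going-up property for differential ideals; (4) if $f$ has the going-down property, then $f$ has the going-down property for differential ideals.
   Context: Rings are commutative with identity and homomorphisms preserve the identity. A differential ring ($\Delta$-ring) is a ring with a set $\Delta$ of derivations; a differential homomorphism is a ring homomorphism commuting with the derivations in $\Delta$; a differential ideal is an ideal stable under all derivations in $\Delta$. A differential ring $A$ is a Keigher ring if the radical of every differential ideal of $A$ is a differential ideal. $\operatorname{Spec}A$ is the set of prime ideals of $A$, and $\operatorname{Spec}^\Delta A\subseteq \operatorname{Spec}A$ is the set of prime differential ideals. For $f\colon A\to B$, the map $f^*\colon\operatorname{Spec}B\to\operatorname{Spec}A$ is $f^*(\mathfrak q)=f^{-1}(\mathfrak q)$, and $f^*_\Delta\colon\operatorname{Spec}^\Delta B\to\operatorname{Spec}^\Delta A$ is its restriction to prime differential ideals. Going-up property of a ring homomorphism $f\colon A\to B$: given any chain $\mathfrak p_1\subseteq\dots\subseteq\mathfrak p_n$ in $\operatorname{Spec} f(A)$ and any nonempty chain $\mathfrak q_1\subseteq\dots\subseteq\mathfrak q_m$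 ($m<n$) in $\operatorname{Spec}B$ with $\mathfrak q_i\cap f(A)=\mathfrak p_i$ for $1\le i\le m$, the latter can be extended to a chain $\mathfrak q_1\subseteq\dots\subseteq\mathfrak q_n$ in $\operatorname{Spec}B$ with $\mathfrak q_i\cap f(A)=\mathfrak p_i$ for $1\le i\le n$. Going-down property: the same with all inclusions $\subseteq$ in the chains replaced by $\supseteq$. The going-up (going-down) property for differential ideals of a differential homomorphism is obtained by replacing all chains of prime ideals (of $f(A)$ and of $B$) by chains of prime differential ideals. *)

theory Defs
  imports "HOL-Algebra.Algebra"
begin

definition derivation :: "('a, 'm) ring_scheme \<Rightarrow> ('a \<Rightarrow> 'a) \<Rightarrow> bool" where
  "derivation R D \<longleftrightarrow>
     D \<in> carrier R \<rightarrow> carrier R \<and>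
     (\<forall>a \<in> carrier R. \<forall>b \<in> carrier R.
        D (a \<oplus>\<^bsub>R\<^esub> b) = D a \<oplus>\<^bsub>R\<^esub> D b \<and>
        D (a \<otimes>\<^bsub>R\<^esub> b) = (D a \<otimes>\<^bsub>R\<^esub> b) \<oplus>\<^bsub>R\<^esub> (a \<otimes>\<^bsub>R\<^esub> D b))"

text \<open>
  The same set \<open>\<Delta>\<close> acts on several rings, so its elements are symbols, and each ring
  carries an interpretation \<open>d\<close> of these symbols as derivations. The derivations need not commute,
  and \<open>\<Delta>\<close> may be empty or infinite.
\<close>

locale differential_ring = cring R
  for R :: "('a, 'm) ring_scheme" (structure) and \<Delta> :: "'d set" and d :: "'d \<Rightarrow> 'a \<Rightarrow> 'a" +
  assumes derivation: "\<delta> \<in> \<Delta> \<Longrightarrow> derivation R (d \<delta>)"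

definition differential_ideal ::
    "('a, 'm) ring_scheme \<Rightarrow> 'd set \<Rightarrow> ('d \<Rightarrow> 'a \<Rightarrow> 'a) \<Rightarrow> 'a set \<Rightarrow> bool" where
  "differential_ideal R \<Delta> d I \<longleftrightarrow> ideal I R \<and> (\<forall>\<delta> \<in> \<Delta>. \<forall>a \<in> I. d \<delta> a \<in> I)"

definition radical :: "('a, 'm) ring_scheme \<Rightarrow> 'a set \<Rightarrow> 'a set" where
  "radical R I = {a \<in> carrier R. \<exists>n::nat. n > 0 \<and> a [^]\<^bsub>R\<^esub> n \<in> I}"

locale keigher_ring = differential_ring +
  assumes radical_differential:
    "differential_ideal R \<Delta> d I \<Longrightarrow> differential_ideal R \<Delta> d (radical R I)"

definition differential_hom ::
    "('a, 'm) ring_scheme \<Rightarrow> ('b, 'n) ring_scheme \<Rightarrow> 'd set \<Rightarrow>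
     ('d \<Rightarrow> 'a \<Rightarrow> 'a) \<Rightarrow> ('d \<Rightarrow> 'b \<Rightarrow> 'b) \<Rightarrow> ('a \<Rightarrow> 'b) \<Rightarrow> bool" where
  "differential_hom A B \<Delta> dA dB f \<longleftrightarrow>
     f \<in> ring_hom A B \<and> (\<forall>\<delta> \<in> \<Delta>. \<forall>a \<in> carrier A. f (dA \<delta> a) = dB \<delta> (f a))"

definition Spec :: "('a, 'm) ring_scheme \<Rightarrow> 'a set set" where
  "Spec R = {P. primeideal P R}"

definition diff_Spec :: "('a, 'm) ring_scheme \<Rightarrow> 'd set \<Rightarrow> ('d \<Rightarrow> 'a \<Rightarrow> 'a) \<Rightarrow> 'a set set" where
  "diff_Spec R \<Delta> d = {P \<in> Spec R. differential_ideal R \<Delta> d P}"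

text \<open>
  \<open>spec_map A f\<close> is the contraction map on subsets of the target ring; both the map on \<open>Spec\<close> and
  its differential version are restrictions of it, so below it is always intersected with, or
  applied to, the relevant domain.
\<close>

definition spec_map :: "('a, 'm) ring_scheme \<Rightarrow> ('a \<Rightarrow> 'b) \<Rightarrow> 'b set \<Rightarrow> 'a set" where
  "spec_map A f Q = f -` Q \<inter> carrier A"

definition image_ring ::
    "('a, 'm) ring_scheme \<Rightarrow> ('b, 'n) ring_scheme \<Rightarrow> ('a \<Rightarrow> 'b) \<Rightarrow> ('b, 'n) ring_scheme" where
  "image_ring A B f = B\<lparr>carrier := f ` carrier A\<rparr>"

text \<open>
  \<open>chain_lifting r S U V\<close>: every chain \<open>p 1, \<dots>, p n\<close> in \<open>U\<close>, together with a nonempty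
  chain \<open>q 1, \<dots>, q m\<close> in \<open>V\<close>, \<open>m < n\<close>, lying over its beginning (that is, with
  \<open>q i \<inter> S = p i\<close>), admits an extension of the second chain to a chain \<open>q' 1, \<dots>, q' n\<close> in \<open>V\<close>
  lying over all of the first. Chains are monotone with respect to \<open>r\<close>; repetitions are allowed.
\<close>

definition chain_lifting ::
    "('b set \<Rightarrow> 'b set \<Rightarrow> bool) \<Rightarrow> 'b set \<Rightarrow> 'b set set \<Rightarrow> 'b set set \<Rightarrow> bool" where
  "chain_lifting r S U V \<longleftrightarrow>
     (\<forall>(n::nat) (m::nat) p q.
        1 \<le> m \<and> m < n \<and>
        (\<forall>i \<in> {1..n}. p i \<in> U) \<and> monotone_on {1..n} (\<le>) r p \<and>
        (\<forall>i \<in> {1..m}. q i \<in> V) \<and> monotone_on {1..m} (\<le>) r q \<and>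
        (\<forall>i \<in> {1..m}. q i \<inter> S = p i) \<longrightarrow>
        (\<exists>q'. (\<forall>i \<in> {1..m}. q' i = q i) \<and>
              (\<forall>i \<in> {1..n}. q' i \<in> V) \<and> monotone_on {1..n} (\<le>) r q' \<and>
              (\<forall>i \<in> {1..n}. q' i \<inter> S = p i)))"

definition going_up ::
    "('a, 'm) ring_scheme \<Rightarrow> ('b, 'n) ring_scheme \<Rightarrow> ('a \<Rightarrow> 'b) \<Rightarrow> bool" where
  "going_up A B f \<longleftrightarrow>
     chain_lifting (\<subseteq>) (f ` carrier A) (Spec (image_ring A B f)) (Spec B)"

definition going_down ::
    "('a, 'm) ring_scheme \<Rightarrow> ('b, 'n) ring_scheme \<Rightarrow> ('a \<Rightarrow> 'b) \<Rightarrow> bool" where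
  "going_down A B f \<longleftrightarrow>
     chain_lifting (\<supseteq>) (f ` carrier A) (Spec (image_ring A B f)) (Spec B)"

definition diff_going_up ::
    "('a, 'm) ring_scheme \<Rightarrow> ('b, 'n) ring_scheme \<Rightarrow> 'd set \<Rightarrow> ('d \<Rightarrow> 'b \<Rightarrow> 'b) \<Rightarrow> ('a \<Rightarrow> 'b) \<Rightarrow> bool" where
  "diff_going_up A B \<Delta> dB f \<longleftrightarrow>
     chain_lifting (\<subseteq>) (f ` carrier A) (diff_Spec (image_ring A B f) \<Delta> dB) (diff_Spec B \<Delta> dB)"

definition diff_going_down ::
    "('a, 'm) ring_scheme \<Rightarrow> ('b, 'n) ring_scheme \<Rightarrow> 'd set \<Rightarrow> ('d \<Rightarrow> 'b \<Rightarrow> 'b) \<Rightarrow> ('a \<Rightarrow> 'b) \<Rightarrow> bool" where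
  "diff_going_down A B \<Delta> dB f \<longleftrightarrow>
     chain_lifting (\<supseteq>) (f ` carrier A) (diff_Spec (image_ring A B f) \<Delta> dB) (diff_Spec B \<Delta> dB)"

end

(*
  Let q be a prime ideal of a Keigher ring and q# the largest differential ideal inside q, i.e. the
  set of elements all of whose iterated derivatives lie in q. Then q# is prime: it equals its own
  radical, so every (q# : b) is a differential ideal, and by maximality such a colon ideal either
  is contained in q# or meets the complement of q. The operation q |-> q# is monotone, fixes
  differential ideals, and commutes with contraction whenever the contraction of q is differential.
  Hence a lift of primes, or of a whole chain of primes, becomes a differential lift on applying
  it everywhere.
*)

theory Submission
  imports Defs
begin

section \<open>Differential cores and stable sets\<close>

text \<open>The derivations need not commute, so iterated derivatives are indexed by words.
  \<open>fold\<close> applies the head of the word first, and the empty word gives the element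
  itself.\<close>

definition differential_core ::
    "('a, 'm) ring_scheme \<Rightarrow> 'd set \<Rightarrow> ('d \<Rightarrow> 'a \<Rightarrow> 'a) \<Rightarrow> 'a set \<Rightarrow> 'a set" where
  "differential_core R \<Delta> d Q = {a \<in> carrier R. \<forall>w \<in> lists \<Delta>. fold d w a \<in> Q}"

lemma differential_core_mono:
  "P \<subseteq> Q \<Longrightarrow> differential_core R \<Delta> d P \<subseteq> differential_core R \<Delta> d Q"
  unfolding differential_core_def by auto

lemma differential_core_subset: "differential_core R \<Delta> d Q \<subseteq> Q"
proof
  fix a assume "a \<in> differential_core R \<Delta> d Q"
  then have "fold d [] a \<in> Q"
    unfolding differential_core_def by blast
  then show "a \<in> Q" by simp
qed

lemma fold_in_stable:
  assumes "\<forall>\<delta> \<in> \<Delta>. \<forall>a \<in> S. d \<delta> a \<in> S" "w \<in> lists \<Delta>" "a \<in> S"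
  shows "fold d w a \<in> S"
  using assms(2,3)
proof (induction w arbitrary: a)
  case (Cons \<delta> w)
  then have "d \<delta> a \<in> S" using assms(1) by blast
  then show ?case using Cons by simp
qed simp

lemma stable_subset_differential_core:
  assumes "\<forall>\<delta> \<in> \<Delta>. \<forall>a \<in> S. d \<delta> a \<in> S" "S \<subseteq> carrier R" "S \<subseteq> Q"
  shows "S \<subseteq> differential_core R \<Delta> d Q"
  using assms fold_in_stable[OF assms(1)] unfolding differential_core_def by blast

lemma differential_ideal_subset_core:
  assumes "differential_ideal R \<Delta> d I" "I \<subseteq> Q"
  shows "I \<subseteq> differential_core R \<Delta> d Q"
proof (rule stable_subset_differential_core)
  show "I \<subseteq> carrier R"
    using assms(1) additive_subgroup.a_subset ideal.axioms(1)
    unfolding differential_ideal_def by blast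
  show "\<forall>\<delta> \<in> \<Delta>. \<forall>a \<in> I. d \<delta> a \<in> I"
    using assms(1) unfolding differential_ideal_def by (rule conjunct2)
qed (rule assms(2))

lemma differential_core_differential_ideal:
  "differential_ideal R \<Delta> d I \<Longrightarrow> differential_core R \<Delta> d I = I"
  using differential_ideal_subset_core differential_core_subset by (metis equalityI order_refl)

section \<open>Ideals, colon ideals and radicals in commutative rings\<close>

context cring
begin

lemma idealI_cring:
  assumes "I \<subseteq> carrier R" "\<zero> \<in> I"
    and add: "\<And>a b. a \<in> I \<Longrightarrow> b \<in> I \<Longrightarrow> a \<oplus> b \<in> I"
    and mult: "\<And>a x. a \<in> I \<Longrightarrow> x \<in> carrier R \<Longrightarrow> x \<otimes> a \<in> I"
  shows "ideal I R"
proof (rule idealI)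
  show "subgroup I (add_monoid R)"
  proof
    fix a assume a: "a \<in> I"
    \<comment> \<open>Negation is multiplication by \<open>\<ominus> \<one>\<close>, so absorption
      yields closure under additive inverses.\<close>
    then have "\<ominus> a = (\<ominus> \<one>) \<otimes> a"
      using assms(1) by (simp add: l_minus subset_iff)
    then show "inv\<^bsub>add_monoid R\<^esub> a \<in> I"
      using mult[OF a, of "\<ominus> \<one>"] by (simp add: a_inv_def)
  qed (use assms in auto)
  show "\<And>a x. a \<in> I \<Longrightarrow> x \<in> carrier R \<Longrightarrow> a \<otimes> x \<in> I"
    using mult assms(1) m_comm by (metis subsetD)
qed (use mult ring_axioms in auto)

lemma ideal_colon:
  assumes "ideal I R" "b \<in> carrier R"
  shows "ideal {x \<in> carrier R. x \<otimes> b \<in> I} R"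
proof -
  interpret I: ideal I R by fact
  show ?thesis
    by (rule idealI_cring) (use assms(2) I.I_l_closed in \<open>auto simp: l_distr m_assoc\<close>)
qed

lemma radical_subset_primeideal:
  assumes "primeideal Q R" "I \<subseteq> Q"
  shows "radical R I \<subseteq> Q"
proof
  interpret Q: primeideal Q R by fact
  fix a assume "a \<in> radical R I"
  then obtain n :: nat where a: "a \<in> carrier R" and "a [^] n \<in> Q"
    using assms(2) unfolding radical_def by auto
  from this(2) show "a \<in> Q"
  proof (induction n)
    \<comment> \<open>The zeroth power is \<open>\<one>\<close>, which the proper ideal
      \<open>Q\<close> cannot contain.\<close>
    case 0
    then show ?case
      using Q.I_notcarr Q.one_imp_carrier by simp
  next
    case (Suc n)
    then show ?case
      using Q.I_prime[of "a [^] n" a] a by auto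
  qed
qed

end

section \<open>Iterated derivations and differential ideals\<close>

context differential_ring
begin

lemma d_closed: "\<delta> \<in> \<Delta> \<Longrightarrow> a \<in> carrier R \<Longrightarrow> d \<delta> a \<in> carrier R"
  and d_add: "\<delta> \<in> \<Delta> \<Longrightarrow> a \<in> carrier R \<Longrightarrow> b \<in> carrier R \<Longrightarrow> d \<delta> (a \<oplus> b) = d \<delta> a \<oplus> d \<delta> b"
  and d_mult: "\<delta> \<in> \<Delta> \<Longrightarrow> a \<in> carrier R \<Longrightarrow> b \<in> carrier R \<Longrightarrow>
    d \<delta> (a \<otimes> b) = d \<delta> a \<otimes> b \<oplus> a \<otimes> d \<delta> b"
  using derivation[of \<delta>] unfolding derivation_def by auto

lemma fold_d_add:
  "w \<in> lists \<Delta> \<Longrightarrow> a \<in> carrier R \<Longrightarrow> b \<in> carrier R \<Longrightarrow>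
    fold d w (a \<oplus> b) = fold d w a \<oplus> fold d w b"
  by (induction w arbitrary: a b) (auto simp: d_add d_closed)

text \<open>In the Leibniz rule for \<open>\<zero> \<otimes> \<zero>\<close> both terms have a
  factor \<open>\<zero>\<close>.\<close>

lemma d_zero:
  assumes "\<delta> \<in> \<Delta>" shows "d \<delta> \<zero> = \<zero>"
  using d_mult[OF assms, of \<zero> \<zero>] d_closed[OF assms, of \<zero>] by simp

lemma differential_core_d_closed:
  assumes "\<delta> \<in> \<Delta>" "a \<in> differential_core R \<Delta> d Q"
  shows "d \<delta> a \<in> differential_core R \<Delta> d Q"
proof -
  have "fold d w (d \<delta> a) \<in> Q" if "w \<in> lists \<Delta>" for w
  proof -
    \<comment> \<open>Differentiating by \<open>\<delta>\<close> before applying \<open>w\<close>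
      amounts to prepending the letter \<open>\<delta>\<close> to the word.\<close>
    have "\<delta> # w \<in> lists \<Delta>" using that assms(1) by simp
    then have "fold d (\<delta> # w) a \<in> Q"
      using assms(2) unfolding differential_core_def by blast
    then show ?thesis by simp
  qed
  then show ?thesis
    using assms d_closed unfolding differential_core_def by auto
qed

lemma differential_ideal_core:
  assumes "ideal Q R"
  shows "differential_ideal R \<Delta> d (differential_core R \<Delta> d Q)" (is "differential_ideal R \<Delta> d ?M")
proof -
  interpret Q: ideal Q R by fact
  \<comment> \<open>The Leibniz rule splits one derivative of \<open>x \<otimes> a\<close> into two
    products whose second factors, \<open>a\<close> and \<open>d \<delta> a\<close>, are again in
    \<open>?M\<close>. The induction therefore keeps \<open>x\<close> and \<open>a\<close> arbitrary
    and assumes \<open>a \<in> ?M\<close>, since \<open>Q\<close> itself need not be stable.\<close>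
  have mult: "fold d w (x \<otimes> a) \<in> Q"
    if "w \<in> lists \<Delta>" "x \<in> carrier R" "a \<in> ?M" for w x a
    using that
  proof (induction w arbitrary: x a)
    case Nil
    then show ?case
      using Q.I_l_closed differential_core_subset[of R \<Delta> d Q] by auto
  next
    case (Cons \<delta> w)
    have "a \<in> carrier R" using Cons.prems unfolding differential_core_def by auto
    then show ?case
      using Cons by (auto simp: d_mult fold_d_add d_closed differential_core_d_closed)
  qed
  have "ideal ?M R"
  proof (rule idealI_cring)
    have "fold d w \<zero> \<in> {\<zero>}" if "w \<in> lists \<Delta>" for w
      using that by (rule fold_in_stable[rotated]) (auto simp: d_zero)
    then show "\<zero> \<in> ?M" unfolding differential_core_def by auto
  qed (use mult in \<open>auto simp: differential_core_def fold_d_add\<close>)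
  then show ?thesis
    using differential_core_d_closed unfolding differential_ideal_def by blast
qed

text \<open>Differentiating \<open>x \<otimes> b\<close> places only a sum of two terms in
  \<open>I\<close>. The wanted term can be isolated up to its square, and the hypothesis on the
  radical removes the square.\<close>

lemma differential_ideal_colon:
  assumes I: "differential_ideal R \<Delta> d I" and rad: "radical R I \<subseteq> I" and b: "b \<in> carrier R"
  shows "differential_ideal R \<Delta> d {x \<in> carrier R. x \<otimes> b \<in> I}"
proof -
  interpret I: ideal I R using I unfolding differential_ideal_def by blast
  have "d \<delta> x \<otimes> b \<in> I" if \<delta>: "\<delta> \<in> \<Delta>" and x: "x \<in> carrier R" and xb: "x \<otimes> b \<in> I" for \<delta> x
  proof -
    note c = d_closed[OF \<delta> x] d_closed[OF \<delta> b] x b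
    have i1: "d \<delta> x \<otimes> b \<oplus> x \<otimes> d \<delta> b \<in> I"
      using I \<delta> xb unfolding differential_ideal_def by (metis d_mult b x)
    have i2: "(d \<delta> b \<otimes> d \<delta> x) \<otimes> (x \<otimes> b) \<in> I"
      using I.I_l_closed[OF xb] c by simp
    \<comment> \<open>Multiplying \<open>x' b + x b' \<in> I\<close> by \<open>x' b\<close> leaves the square of \<open>x' b\<close> modulo \<open>x b\<close>.\<close>
    have "(d \<delta> x \<otimes> b) \<otimes> (d \<delta> x \<otimes> b)
        = (d \<delta> x \<otimes> b) \<otimes> (d \<delta> x \<otimes> b \<oplus> x \<otimes> d \<delta> b) \<ominus> (d \<delta> b \<otimes> d \<delta> x) \<otimes> (x \<otimes> b)"
      using c by algebra
    also have "\<dots> \<in> I"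
      using I.I_l_closed[OF i1, of "d \<delta> x \<otimes> b"] i2 c by (simp add: a_minus_def)
    finally have "(d \<delta> x \<otimes> b) [^] (2::nat) \<in> I"
      using c by (simp add: numeral_2_eq_2)
    then have "d \<delta> x \<otimes> b \<in> radical R I"
      using c unfolding radical_def by (auto intro!: exI[of _ "2::nat"])
    then show ?thesis using rad by blast
  qed
  then show ?thesis
    using ideal_colon[OF I.ideal_axioms b] d_closed unfolding differential_ideal_def by auto
qed

end

section \<open>Primality of the core in a Keigher ring\<close>

lemma (in keigher_ring) differential_core_diff_Spec:
  assumes "Q \<in> Spec R"
  shows "differential_core R \<Delta> d Q \<in> diff_Spec R \<Delta> d" (is "?M \<in> _")
proof -
  interpret Q: primeideal Q R using assms unfolding Spec_def by blast
  have M: "differential_ideal R \<Delta> d ?M"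
    by (rule differential_ideal_core[OF Q.ideal_axioms])
  have MQ: "?M \<subseteq> Q" by (rule differential_core_subset)
  interpret M: ideal ?M R using M unfolding differential_ideal_def by blast
  \<comment> \<open>The Keigher property makes the radical of \<open>?M\<close> a differential
    ideal. It lies in \<open>Q\<close> because \<open>Q\<close> is prime, so maximality of the core
    puts it in \<open>?M\<close>.\<close>
  have rad: "radical R ?M \<subseteq> ?M"
    using differential_ideal_subset_core[OF radical_differential[OF M]]
      radical_subset_primeideal[OF Q.primeideal_axioms MQ] .
  \<comment> \<open>Otherwise the colon ideal of \<open>?M\<close> by \<open>b\<close> would be a
    differential ideal inside \<open>Q\<close>, hence inside \<open>?M\<close>; but it contains
    \<open>a\<close>.\<close>
  have escape: "\<exists>s \<in> carrier R. s \<otimes> b \<in> ?M \<and> s \<notin> Q"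
    if "a \<in> carrier R" "b \<in> carrier R" "a \<otimes> b \<in> ?M" "a \<notin> ?M" for a b
    using differential_ideal_subset_core[OF differential_ideal_colon[OF M rad that(2)], of Q] that
    by blast
  have "primeideal ?M R"
  proof (rule primeidealI[OF M.ideal_axioms])
    show "carrier R \<noteq> ?M"
      using MQ Q.I_notcarr Q.a_subset by blast
  next
    fix a b assume ab: "a \<in> carrier R" "b \<in> carrier R" "a \<otimes> b \<in> ?M"
    show "a \<in> ?M \<or> b \<in> ?M"
    proof (rule ccontr)
      assume "\<not> (a \<in> ?M \<or> b \<in> ?M)"
      then obtain s where s: "s \<in> carrier R" "s \<otimes> b \<in> ?M" "s \<notin> Q" and "b \<notin> ?M"
        using escape ab by blast
      \<comment> \<open>The escape is used a second time with \<open>b\<close> as the element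
        outside \<open>?M\<close> and \<open>s\<close> as the multiplier. Then \<open>t\<close> and
        \<open>s\<close> both avoid \<open>Q\<close> while their product lies in
        \<open>?M \<subseteq> Q\<close>, against primality of \<open>Q\<close>.\<close>
      then obtain t where "t \<in> carrier R" "t \<otimes> s \<in> ?M" "t \<notin> Q"
        using escape[of b s] ab(2) m_comm by metis
      then show False
        using Q.I_prime s MQ by blast
    qed
  qed (rule is_cring)
  then show ?thesis using M unfolding diff_Spec_def Spec_def by blast
qed

section \<open>Differential lifting of chains\<close>

text \<open>Keeping the relation \<open>r\<close> abstract handles going-up and going-down together:
  forming cores only has to respect it. Members of \<open>U'\<close> enter as stable subsets of
  \<open>B\<close>, since they are ideals of the image ring only.\<close>

lemma keigher_chain_lifting:
  assumes "keigher_ring B \<Delta> d"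
    and mono: "\<And>P Q. r P Q \<Longrightarrow> r (differential_core B \<Delta> d P) (differential_core B \<Delta> d Q)"
    and U: "\<And>p. p \<in> U' \<Longrightarrow> p \<in> U \<and> p \<subseteq> carrier B \<and> (\<forall>\<delta> \<in> \<Delta>. \<forall>a \<in> p. d \<delta> a \<in> p)"
    and lift: "chain_lifting r S U (Spec B)"
  shows "chain_lifting r S U' (diff_Spec B \<Delta> d)"
  unfolding chain_lifting_def
proof (intro allI impI, elim conjE)
  fix n m :: nat and p q
  assume "1 \<le> m" "m < n" and p: "\<forall>i \<in> {1..n}. p i \<in> U'" and "monotone_on {1..n} (\<le>) r p"
    and q: "\<forall>i \<in> {1..m}. q i \<in> diff_Spec B \<Delta> d" and "monotone_on {1..m} (\<le>) r q"
    and "\<forall>i \<in> {1..m}. q i \<inter> S = p i"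
  moreover have "\<forall>i \<in> {1..n}. p i \<in> U" "\<forall>i \<in> {1..m}. q i \<in> Spec B"
    using p q U unfolding diff_Spec_def by auto
  ultimately obtain q' where q': "\<forall>i \<in> {1..m}. q' i = q i" "\<forall>i \<in> {1..n}. q' i \<in> Spec B"
    "monotone_on {1..n} (\<le>) r q'" "\<forall>i \<in> {1..n}. q' i \<inter> S = p i"
    using lift[unfolded chain_lifting_def, rule_format, of m n p q] by blast
  \<comment> \<open>Taking cores leaves the prescribed initial segment unchanged, because its
    members are already differential ideals.\<close>
  let ?q = "\<lambda>i. differential_core B \<Delta> d (q' i)"
  show "\<exists>q'. (\<forall>i \<in> {1..m}. q' i = q i) \<and> (\<forall>i \<in> {1..n}. q' i \<in> diff_Spec B \<Delta> d) \<and>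
      monotone_on {1..n} (\<le>) r q' \<and> (\<forall>i \<in> {1..n}. q' i \<inter> S = p i)"
  proof (intro exI[of _ ?q] conjI ballI)
    show "?q i = q i" if "i \<in> {1..m}" for i
      using that q q'(1) differential_core_differential_ideal[of B \<Delta> d "q i"]
      unfolding diff_Spec_def by simp
    show "?q i \<in> diff_Spec B \<Delta> d" if "i \<in> {1..n}" for i
      using that q'(2) keigher_ring.differential_core_diff_Spec[OF assms(1)] by blast
    show "monotone_on {1..n} (\<le>) r ?q"
      using q'(3) mono unfolding monotone_on_def by blast
    show "?q i \<inter> S = p i" if "i \<in> {1..n}" for i
    proof -
      \<comment> \<open>\<open>p i\<close> is a stable subset of \<open>q' i\<close>, so it survives
        in the core; the converse inclusion holds because the core only shrinks
        \<open>q' i\<close>.\<close>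
      have "p i \<subseteq> ?q i"
        by (rule stable_subset_differential_core) (use U p q'(4) that in blast)+
      then show ?thesis
        using q'(4) that differential_core_subset[of B \<Delta> d "q' i"] by blast
    qed
  qed
qed

text \<open>Supplies what \<open>keigher_chain_lifting\<close> asks of the lower chain. The image
  ring differs from \<open>B\<close> only in its carrier, so stability under \<open>d\<close>
  carries over verbatim.\<close>

lemma diff_Spec_image_ring:
  assumes "f ` carrier A \<subseteq> carrier B" "p \<in> diff_Spec (image_ring A B f) \<Delta> d"
  shows "p \<in> Spec (image_ring A B f) \<and> p \<subseteq> carrier B \<and> (\<forall>\<delta> \<in> \<Delta>. \<forall>a \<in> p. d \<delta> a \<in> p)"
proof -
  have "p \<in> Spec (image_ring A B f)" "differential_ideal (image_ring A B f) \<Delta> d p"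
    using assms(2) unfolding diff_Spec_def by auto
  moreover have "p \<subseteq> carrier (image_ring A B f)"
    using \<open>differential_ideal (image_ring A B f) \<Delta> d p\<close> additive_subgroup.a_subset ideal.axioms(1)
    unfolding differential_ideal_def by blast
  ultimately show ?thesis
    using assms(1) unfolding differential_ideal_def image_ring_def by auto
qed

section \<open>Contraction along a differential homomorphism\<close>

lemma spec_map_diff_Spec:
  assumes "differential_ring A \<Delta> dA" "cring B" "differential_hom A B \<Delta> dA dB f"
    and Q: "Q \<in> diff_Spec B \<Delta> dB"
  shows "spec_map A f Q \<in> diff_Spec A \<Delta> dA"
proof -
  interpret A: differential_ring A \<Delta> dA by fact
  interpret B: cring B by fact
  interpret f: ring_hom_ring A B f
    using assms(3) A.ring_axioms B.ring_axioms
    unfolding differential_hom_def by (intro ring_hom_ringI2) auto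
  have *: "spec_map A f Q = {r \<in> carrier A. f r \<in> Q}"
    unfolding spec_map_def by auto
  have "primeideal {r \<in> carrier A. f r \<in> Q} A"
    using f.primeideal_vimage[OF A.is_cring, of Q] Q unfolding diff_Spec_def Spec_def by blast
  moreover have "f (dA \<delta> a) \<in> Q" if "\<delta> \<in> \<Delta>" "a \<in> carrier A" "f a \<in> Q" for \<delta> a
    using that assms(3) Q unfolding differential_hom_def diff_Spec_def differential_ideal_def by auto
  ultimately show ?thesis
    unfolding * diff_Spec_def Spec_def differential_ideal_def
    using primeideal.axioms(1) A.d_closed by auto
qed

lemma spec_map_differential_core:
  assumes "differential_hom A B \<Delta> dA dB f" "P \<in> diff_Spec A \<Delta> dA" "spec_map A f Q = P"
  shows "spec_map A f (differential_core B \<Delta> dB Q) = P"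
proof -
  have P: "\<forall>\<delta> \<in> \<Delta>. \<forall>a \<in> P. dA \<delta> a \<in> P" "P \<subseteq> carrier A"
    using assms(2,3) unfolding diff_Spec_def differential_ideal_def spec_map_def by auto
  have "f ` P \<subseteq> differential_core B \<Delta> dB Q"
  proof (rule stable_subset_differential_core)
    have "dB \<delta> (f a) = f (dA \<delta> a)" if "\<delta> \<in> \<Delta>" "a \<in> P" for \<delta> a
      using that P(2) assms(1) unfolding differential_hom_def by auto
    then show "\<forall>\<delta> \<in> \<Delta>. \<forall>b \<in> f ` P. dB \<delta> b \<in> f ` P"
      using P(1) by auto
    show "f ` P \<subseteq> carrier B"
      using P(2) assms(1) ring_hom_closed unfolding differential_hom_def by fastforce
    show "f ` P \<subseteq> Q"
      using assms(3) unfolding spec_map_def by auto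
  qed
  then show ?thesis
    using P(2) assms(3) differential_core_subset[of B \<Delta> dB Q] unfolding spec_map_def by blast
qed

theorem mainTheorem1:
  fixes A :: "('a, 'm) ring_scheme" and B :: "('b, 'n) ring_scheme"
    and \<Delta> :: "'d set" and dA :: "'d \<Rightarrow> 'a \<Rightarrow> 'a" and dB :: "'d \<Rightarrow> 'b \<Rightarrow> 'b"
    and f :: "'a \<Rightarrow> 'b" and P :: "'a set"
  assumes "keigher_ring A \<Delta> dA" and "keigher_ring B \<Delta> dB"
    and "differential_hom A B \<Delta> dA dB f"
    and "P \<in> diff_Spec A \<Delta> dA"
  shows "(spec_map A f -` {P} \<inter> Spec B \<noteq> {} \<longrightarrow>
            spec_map A f -` {P} \<inter> diff_Spec B \<Delta> dB \<noteq> {}) \<and>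
         (spec_map A f ` Spec B = Spec A \<longrightarrow>
            spec_map A f ` diff_Spec B \<Delta> dB = diff_Spec A \<Delta> dA) \<and>
         (going_up A B f \<longrightarrow> diff_going_up A B \<Delta> dB f) \<and>
         (going_down A B f \<longrightarrow> diff_going_down A B \<Delta> dB f)"
proof -
  interpret A: keigher_ring A \<Delta> dA by fact
  interpret B: keigher_ring B \<Delta> dB by fact
  \<comment> \<open>The witness is the core of \<open>Q\<close>; this serves both the fibre
    statement and surjectivity.\<close>
  have lift: "\<exists>Q' \<in> diff_Spec B \<Delta> dB. spec_map A f Q' = p"
    if "p \<in> diff_Spec A \<Delta> dA" "Q \<in> Spec B" "spec_map A f Q = p" for p Q
    using spec_map_differential_core[OF assms(3) that(1,3)] B.differential_core_diff_Spec[OF that(2)]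
    by blast
  have contr: "spec_map A f Q \<in> diff_Spec A \<Delta> dA" if "Q \<in> diff_Spec B \<Delta> dB" for Q
    using spec_map_diff_Spec[OF A.differential_ring_axioms B.is_cring assms(3) that] .
  have im: "f ` carrier A \<subseteq> carrier B"
    using assms(3) ring_hom_closed unfolding differential_hom_def by fastforce
  note chain = keigher_chain_lifting[OF assms(2) _ diff_Spec_image_ring[OF im]]
  show ?thesis
  proof (intro conjI impI)
    assume "spec_map A f -` {P} \<inter> Spec B \<noteq> {}"
    then show "spec_map A f -` {P} \<inter> diff_Spec B \<Delta> dB \<noteq> {}"
      using lift[OF assms(4)] by blast
  next
    assume surj: "spec_map A f ` Spec B = Spec A"
    have "p \<in> spec_map A f ` diff_Spec B \<Delta> dB" if p: "p \<in> diff_Spec A \<Delta> dA" for p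
    proof -
      have "p \<in> spec_map A f ` Spec B"
        using p unfolding surj diff_Spec_def by blast
      then show ?thesis using lift[OF p] by blast
    qed
    then show "spec_map A f ` diff_Spec B \<Delta> dB = diff_Spec A \<Delta> dA"
      using contr by blast
  next
    assume "going_up A B f"
    then show "diff_going_up A B \<Delta> dB f"
      unfolding going_up_def diff_going_up_def
      by (rule chain[rotated -1]) (rule differential_core_mono)
  next
    \<comment> \<open>Monotonicity of the core, read with its two arguments exchanged, also covers
      reversed inclusion.\<close>
    assume "going_down A B f"
    then show "diff_going_down A B \<Delta> dB f"
      unfolding going_down_def diff_going_down_def
      by (rule chain[rotated -1]) (rule differential_core_mono)
  qed
qed

end
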